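(* Let $\alpha_i>0$ for $i\in\mathcal V_I$ and $f(u)=\sum_{i\in\mathcal V_I}\tfrac12\alpha_iu_i^2$. The AC economic dispatch with parameters $\gamma^{(AC)}_{ij}\in[0,\pi/2)$ is: minimize $f(u)$ over $\theta\in\mathbb T^n$, $u\in\mathbb R^{n_I}$ subject to $$P_i^*+u_i=P_{\mathrm e,i}(\theta)\ \forall i\in\mathcal V_I,\quad P_i^*=P_{\mathrm e,i}(\theta)\ \forall i\in\mathcal V_L,\quad |\theta_i-\theta_j|\le\gamma^{(AC)}_{ij}\ \forall\{i,j\}\in\mathcal E,\quad P_{\mathrm e,i}(\theta)\in[0,\overline P_i]\ \forall i\in\mathcal V_I.$$ The DC economic dispatch with parameters $\gamma^{(DC)}_{ij}\in[0,\pi/2)$ is: minimize $f(v)$ over $\delta\in\mathbb R^n$, $v\in\mathbb R^{n_I}$ subject to $$P_i^*+v_i=P_{\mathrm{DC},i}(\delta)\ \forall i\in\mathcal V_I,\quad P_i^*=P_{\mathrm{DC},i}(\delta)\ \forall i\in\mathcal V_L,\quad |\delta_i-\delta_j|\le\gamma^{(DC)}_{ij}\ \forall\{i,j\}\in\mathcal E,\quad P_{\mathrm{DC},i}(\delta)\in[0,\overline P_i]\ \forall i\in\mathcal V_I.$$ Consider these two problems in an acyclic network. The following statements are equivalent: (i) (AC feasibility) the AC economic dispatch problem with parameters $\gamma^{(AC)}_{ij}<\pi/2$ for all $\{i,j\}\in\mathcal E$ is feasible with a global minimizer $(\theta^*,u^* )\in\mathbb T^n\times\mathbb R^{n_I}$;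 (ii) (DC feasibility) the DC economic dispatch problem with parameters $\gamma^{(DC)}_{ij}<1$ for all $\{i,j\}\in\mathcal E$ is feasible with a global minimizer $(\delta^*,v^* )\in\mathbb R^n\times\mathbb R^{n_I}$. If the equivalent statements (i) and (ii) are true, then $\sin(\gamma^{(AC)}_{ij})=\gamma^{(DC)}_{ij}$, $u^*=v^*$, $\boldsymbol{\sin}(B^T\theta^* )=B^T\delta^*$, and $f(u^* )=f(v^* )$ is a global minimum.
   Context: Network: $G(\mathcal V,\mathcal E)$ is a connected, undirected, acyclic graph with node set $\mathcal V=\{1,\dots,n\}$ partitioned into loads and inverters, $\mathcal V=\mathcal V_L\cup\mathcal V_I$, $n_I=|\mathcal V_I|$. $B\in\mathbb R^{n\times|\mathcal E|}$ is its oriented incidence matrix (arbitrary orientation). All lines are purely inductive: $\mathfrak{Im}(Y_{ij})=1/|z_{ij}|>0$ for $\{i,j\}\in\mathcal E$, where $z_{ij}$ is the line impedance, and $Y_{ij}=0$ for $i\neq j$, $\{i,j\}\notin\mathcal E$. Voltage magnitudes $E_i>0$ are constant. The AC and DC active power injections are $$P_{\mathrm e,i}(\theta)=\sum_{j=1}^n\mathfrak{Im}(Y_{ij})E_iE_j\sin(\theta_i-\theta_j),\qquad P_{\mathrm{DC},i}(\delta)=\sum_{j=1}^n\mathfrak{Im}(Y_{ij})E_iE_j(\delta_i-\delta_j).$$ $P_i^*\in\mathbb R$ is the constant injection of load $i\in\mathcal V_L$. For $i\in\mathcal V_I$, $\overline P_i\ge0$ is the inverter rating and $P_i^*\in[0,\overline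 P_i]$ its nominal injection setpoint. Throughout, $0\le-\sum_{i\in\mathcal V_L}P_i^*\le\sum_{i\in\mathcal V_I}\overline P_i$. For angles, $|\theta_i-\theta_j|$ is the geodesic distance on the circle; $\boldsymbol{\sin}$ acts componentwise.
   Formalization: For unrelated parameters the claim fails, so the equivalence is read as existence of admissible parameters; each choice making (i) or (ii) true has a partner with sin(γ^AC)=γ^DC making the other true, and the minimizers are compared for all parameters so matched. *)

theory Defs
  imports "HOL-Analysis.Analysis"
begin

text \<open>
  An undirected simple graph on the nodes of a finite type is given by its set of edges, each edge
  being a two-element set of nodes.
\<close>

definition simple_graph :: "'n set set \<Rightarrow> bool" where
  "simple_graph E \<longleftrightarrow> (\<forall>e\<in>E. card e = 2)"

definition connected_graph :: "'n set set \<Rightarrow> bool" where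
  "connected_graph E \<longleftrightarrow> (\<forall>i j. (i, j) \<in> {(k, l). {k, l} \<in> E}\<^sup>*)"

text \<open>The closing edge of a cycle, from its last node back to its first, is the one with
  \<open>Suc k = length p\<close>.\<close>

definition graph_cycle :: "'n set set \<Rightarrow> 'n list \<Rightarrow> bool" where
  "graph_cycle E p \<longleftrightarrow> 3 \<le> length p \<and> distinct p \<and>
     (\<forall>k<length p. {p ! k, p ! (Suc k mod length p)} \<in> E)"

definition acyclic_graph :: "'n set set \<Rightarrow> bool" where
  "acyclic_graph E \<longleftrightarrow> (\<nexists>p. graph_cycle E p)"

definition orientation :: "'n set set \<Rightarrow> ('n set \<Rightarrow> 'n) \<Rightarrow> ('n set \<Rightarrow> 'n) \<Rightarrow> bool" where
  "orientation E src snk \<longleftrightarrow> (\<forall>e\<in>E. e = {src e, snk e})"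

text \<open>
  The oriented incidence matrix has its columns indexed by edges; only the columns in \<open>E\<close> are
  meaningful.
\<close>

definition incidence :: "('n set \<Rightarrow> 'n) \<Rightarrow> ('n set \<Rightarrow> 'n) \<Rightarrow> 'n \<Rightarrow> 'n set \<Rightarrow> real" where
  "incidence src snk i e = (if i = snk e then 1 else if i = src e then - 1 else 0)"

definition incidence_transpose_mult ::
  "('n \<Rightarrow> 'n set \<Rightarrow> real) \<Rightarrow> real ^ 'n::finite \<Rightarrow> 'n set \<Rightarrow> real" where
  "incidence_transpose_mult B x e = (\<Sum>i\<in>UNIV. B i e * x $ i)"

text \<open>
  A point of the torus is represented by any real vector of lifts of its angles: all notions below
  are invariant under adding integer multiples of \<open>2 * pi\<close> to the components. In particular,
  the distance of two angles is the geodesic distance on the circle of the points they represent.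
\<close>

definition geodesic_dist :: "real \<Rightarrow> real \<Rightarrow> real" where
  "geodesic_dist x y = (INF k::int. \<bar>x - y + 2 * pi * of_int k\<bar>)"

definition P_e :: "('n \<Rightarrow> 'n \<Rightarrow> complex) \<Rightarrow> ('n \<Rightarrow> real) \<Rightarrow> real ^ 'n::finite \<Rightarrow> 'n \<Rightarrow> real" where
  "P_e Y V \<theta> i = (\<Sum>j\<in>UNIV. Im (Y i j) * V i * V j * sin (\<theta> $ i - \<theta> $ j))"

definition P_DC :: "('n \<Rightarrow> 'n \<Rightarrow> complex) \<Rightarrow> ('n \<Rightarrow> real) \<Rightarrow> real ^ 'n::finite \<Rightarrow> 'n \<Rightarrow> real" where
  "P_DC Y V \<delta> i = (\<Sum>j\<in>UNIV. Im (Y i j) * V i * V j * (\<delta> $ i - \<delta> $ j))"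

definition dispatch_cost :: "'n set \<Rightarrow> ('n \<Rightarrow> real) \<Rightarrow> ('n \<Rightarrow> real) \<Rightarrow> real" where
  "dispatch_cost VI \<alpha> u = (\<Sum>i\<in>VI. 1 / 2 * \<alpha> i * (u i)\<^sup>2)"

text \<open>
  A vector indexed by the inverters is an extensional function on \<open>VI\<close>, so that equality of such
  vectors is equality of functions.
\<close>

definition AC_feasible ::
  "'n set set \<Rightarrow> 'n set \<Rightarrow> 'n set \<Rightarrow> ('n \<Rightarrow> 'n \<Rightarrow> complex) \<Rightarrow> ('n \<Rightarrow> real) \<Rightarrow> ('n \<Rightarrow> real) \<Rightarrow> ('n \<Rightarrow> real) \<Rightarrow>
   ('n set \<Rightarrow> real) \<Rightarrow> (real ^ 'n::finite) \<times> ('n \<Rightarrow> real) \<Rightarrow> bool" where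
  "AC_feasible E VL VI Y V P Pbar \<gamma> = (\<lambda>(\<theta>, u).
     u \<in> VI \<rightarrow>\<^sub>E UNIV \<and>
     (\<forall>i\<in>VI. P i + u i = P_e Y V \<theta> i) \<and>
     (\<forall>i\<in>VL. P i = P_e Y V \<theta> i) \<and>
     (\<forall>i j. {i, j} \<in> E \<longrightarrow> geodesic_dist (\<theta> $ i) (\<theta> $ j) \<le> \<gamma> {i, j}) \<and>
     (\<forall>i\<in>VI. P_e Y V \<theta> i \<in> {0..Pbar i}))"

definition DC_feasible ::
  "'n set set \<Rightarrow> 'n set \<Rightarrow> 'n set \<Rightarrow> ('n \<Rightarrow> 'n \<Rightarrow> complex) \<Rightarrow> ('n \<Rightarrow> real) \<Rightarrow> ('n \<Rightarrow> real) \<Rightarrow> ('n \<Rightarrow> real) \<Rightarrow>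
   ('n set \<Rightarrow> real) \<Rightarrow> (real ^ 'n::finite) \<times> ('n \<Rightarrow> real) \<Rightarrow> bool" where
  "DC_feasible E VL VI Y V P Pbar \<gamma> = (\<lambda>(\<delta>, v).
     v \<in> VI \<rightarrow>\<^sub>E UNIV \<and>
     (\<forall>i\<in>VI. P i + v i = P_DC Y V \<delta> i) \<and>
     (\<forall>i\<in>VL. P i = P_DC Y V \<delta> i) \<and>
     (\<forall>i j. {i, j} \<in> E \<longrightarrow> \<bar>\<delta> $ i - \<delta> $ j\<bar> \<le> \<gamma> {i, j}) \<and>
     (\<forall>i\<in>VI. P_DC Y V \<delta> i \<in> {0..Pbar i}))"

definition AC_minimizer ::
  "'n set set \<Rightarrow> 'n set \<Rightarrow> 'n set \<Rightarrow> ('n \<Rightarrow> 'n \<Rightarrow> complex) \<Rightarrow> ('n \<Rightarrow> real) \<Rightarrow> ('n \<Rightarrow> real) \<Rightarrow> ('n \<Rightarrow> real) \<Rightarrow>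
   ('n \<Rightarrow> real) \<Rightarrow> ('n set \<Rightarrow> real) \<Rightarrow> (real ^ 'n::finite) \<times> ('n \<Rightarrow> real) \<Rightarrow> bool" where
  "AC_minimizer E VL VI Y V P Pbar \<alpha> \<gamma> =
     is_arg_min (\<lambda>(\<theta>, u). dispatch_cost VI \<alpha> u) (AC_feasible E VL VI Y V P Pbar \<gamma>)"

definition DC_minimizer ::
  "'n set set \<Rightarrow> 'n set \<Rightarrow> 'n set \<Rightarrow> ('n \<Rightarrow> 'n \<Rightarrow> complex) \<Rightarrow> ('n \<Rightarrow> real) \<Rightarrow> ('n \<Rightarrow> real) \<Rightarrow> ('n \<Rightarrow> real) \<Rightarrow>
   ('n \<Rightarrow> real) \<Rightarrow> ('n set \<Rightarrow> real) \<Rightarrow> (real ^ 'n::finite) \<times> ('n \<Rightarrow> real) \<Rightarrow> bool" where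
  "DC_minimizer E VL VI Y V P Pbar \<alpha> \<gamma> =
     is_arg_min (\<lambda>(\<delta>, v). dispatch_cost VI \<alpha> v) (DC_feasible E VL VI Y V P Pbar \<gamma>)"

text \<open>
  The admissible parameters are part of the two solvability statements; for the DC problem the
  bound \<open>\<gamma> e < 1\<close> comes on top of the range \<open>[0, pi/2)\<close> in which both problems are posed.
\<close>

definition AC_solvable ::
  "'n::finite set set \<Rightarrow> 'n set \<Rightarrow> 'n set \<Rightarrow> ('n \<Rightarrow> 'n \<Rightarrow> complex) \<Rightarrow> ('n \<Rightarrow> real) \<Rightarrow> ('n \<Rightarrow> real) \<Rightarrow>
   ('n \<Rightarrow> real) \<Rightarrow> ('n \<Rightarrow> real) \<Rightarrow> ('n set \<Rightarrow> real) \<Rightarrow> bool" where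
  "AC_solvable E VL VI Y V P Pbar \<alpha> \<gamma> \<longleftrightarrow>
     (\<forall>e\<in>E. \<gamma> e \<in> {0..<pi/2}) \<and>
     (\<exists>\<theta> u. AC_minimizer E VL VI Y V P Pbar \<alpha> \<gamma> (\<theta>, u))"

definition DC_solvable ::
  "'n::finite set set \<Rightarrow> 'n set \<Rightarrow> 'n set \<Rightarrow> ('n \<Rightarrow> 'n \<Rightarrow> complex) \<Rightarrow> ('n \<Rightarrow> real) \<Rightarrow> ('n \<Rightarrow> real) \<Rightarrow>
   ('n \<Rightarrow> real) \<Rightarrow> ('n \<Rightarrow> real) \<Rightarrow> ('n set \<Rightarrow> real) \<Rightarrow> bool" where
  "DC_solvable E VL VI Y V P Pbar \<alpha> \<gamma> \<longleftrightarrow>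
     (\<forall>e\<in>E. \<gamma> e \<in> {0..<pi/2} \<and> \<gamma> e < 1) \<and>
     (\<exists>\<delta> v. DC_minimizer E VL VI Y V P Pbar \<alpha> \<gamma> (\<delta>, v))"

end

(* In an acyclic network every antisymmetric edge function is a difference of node potentials.
   Hence any AC solution theta yields a DC solution delta with
   delta_i - delta_j = sin (theta_i - theta_j) on the lines, and conversely through arcsin, with
   the same injections; so both problems admit the same inverter vectors u. The cost is strictly
   convex and the DC feasible set is convex, so the optimal u is unique, and it determines
   the DC angle differences because the energy form of the weighted Laplacian is positive definite
   on them. *)
theory Submission
  imports Defs
begin

section \<open>Acyclic graphs: edges are bridges, and edge functions have potentials\<close>

lemma rtranclp_shortest_path:
  assumes "r\<^sup>*\<^sup>* a b"
  obtains f :: "nat \<Rightarrow> 'a" and n where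
    "f 0 = a" "f n = b" "\<And>i. i < n \<Longrightarrow> r (f i) (f (Suc i))" "inj_on f {..n}"
proof -
  define n where "n = (LEAST n. (r ^^ n) a b)"
  have "\<exists>n. (r ^^ n) a b"
    using assms by (simp add: rtranclp_power)
  then have "(r ^^ n) a b"
    unfolding n_def by (rule LeastI_ex)
  then obtain f where f: "f 0 = a" "f n = b" "\<And>i. i < n \<Longrightarrow> r (f i) (f (Suc i))"
    by (auto simp: relpowp_fun_conv)
  \<comment> \<open>If a node were visited twice, the stretch between the visits could be cut out,
    leaving a walk of \<open>i + (n - j) < n\<close> steps, against the minimality of
    \<open>n\<close>.\<close>
  have "f i \<noteq> f j" if "i < j" "j \<le> n" for i j
  proof
    assume eq: "f i = f j"
    have "(r ^^ i) a (f i)"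
      using f that by (auto simp: relpowp_fun_conv intro!: exI[of _ f])
    moreover have "(r ^^ (n - j)) (f j) b"
      using f that by (auto simp: relpowp_fun_conv intro!: exI[of _ "\<lambda>k. f (j + k)"])
    ultimately have "(r ^^ (i + (n - j))) a b"
      unfolding eq relpowp_add by (rule relcomppI)
    then have "n \<le> i + (n - j)"
      unfolding n_def by (rule Least_le)
    with that show False
      by linarith
  qed
  then have "inj_on f {..n}"
    by (rule linorder_inj_onI) auto
  with f show thesis
    by (rule that)
qed

text \<open>A path from \<open>a\<close> to \<open>b\<close> that avoids the edge may be taken
  without repeated nodes; the edge itself then closes it to a cycle.\<close>

lemma acyclic_graph_edge_is_bridge:
  assumes "acyclic_graph E" "{a, b} \<in> E" "a \<noteq> b"
  shows "\<not> (\<lambda>k l. {k, l} \<in> E - {{a, b}})\<^sup>*\<^sup>* a b"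
proof
  assume "(\<lambda>k l. {k, l} \<in> E - {{a, b}})\<^sup>*\<^sup>* a b"
  then obtain f and n :: nat where ends: "f 0 = a" "f n = b"
    and step: "\<And>i. i < n \<Longrightarrow> {f i, f (Suc i)} \<in> E - {{a, b}}" and inj: "inj_on f {..n}"
    by (rule rtranclp_shortest_path) blast
  have "n \<noteq> 0"
    using ends assms(3) by metis
  \<comment> \<open>A single step would be the removed edge. So the path has at least two steps,
    hence the three nodes that \<open>graph_cycle\<close> demands.\<close>
  have "n \<noteq> 1"
    using ends step[of 0] by auto
  let ?p = "map f [0..<Suc n]"
  have "{?p ! k, ?p ! (Suc k mod length ?p)} \<in> E" if "k < length ?p" for k
  \<comment> \<open>The list has length \<open>Suc n\<close>, so \<open>k = n\<close> is the closing
    edge from \<open>b\<close> back to \<open>a\<close>.\<close>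
  proof (cases "k = n")
    case True
    then show ?thesis
      using ends assms(2) by (simp del: upt_Suc add: insert_commute)
  next
    case False
    then show ?thesis
      using that step[of k] by (simp del: upt_Suc)
  qed
  moreover have "distinct ?p"
    using inj by (simp del: upt_Suc add: distinct_map atLeast0LessThan lessThan_Suc_atMost)
  moreover have "3 \<le> length ?p"
    using \<open>n \<noteq> 0\<close> \<open>n \<noteq> 1\<close> by simp
  ultimately have "graph_cycle E ?p"
    unfolding graph_cycle_def by blast
  with assms(1) show False
    by (auto simp: acyclic_graph_def)
qed

lemma acyclic_graph_subset:
  "acyclic_graph E \<Longrightarrow> F \<subseteq> E \<Longrightarrow> acyclic_graph F"
  unfolding acyclic_graph_def graph_cycle_def by blast

text \<open>Induction on the edges: a new edge joins two different components of the old graph, and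
  shifting the potential by a constant on one of them fits the new edge without disturbing the old
  ones.\<close>

lemma acyclic_graph_potential:
  fixes g :: "'n \<Rightarrow> 'n \<Rightarrow> real"
  assumes "finite E" "simple_graph E" "acyclic_graph E"
    and anti: "\<And>i j. {i, j} \<in> E \<Longrightarrow> g j i = - g i j"
  shows "\<exists>x. \<forall>i j. {i, j} \<in> E \<longrightarrow> x i - x j = g i j"
  using assms
proof (induction E rule: finite_induct)
  case empty
  then show ?case by simp
next
  case (insert e E)
  have "card e = 2"
    using insert.prems(1) by (simp add: simple_graph_def)
  then obtain a b where e: "e = {a, b}" and "a \<noteq> b"
    by (auto simp: card_2_iff)
  have "simple_graph E"
    using insert.prems(1) by (simp add: simple_graph_def)
  moreover have "acyclic_graph E"
    using insert.prems(2) by (rule acyclic_graph_subset) auto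
  ultimately obtain x where x: "\<And>i j. {i, j} \<in> E \<Longrightarrow> x i - x j = g i j"
    using insert.IH insert.prems(3) by (metis insertCI)
  \<comment> \<open>\<open>C\<close> is the component of \<open>a\<close> before the new edge is
    added; it misses \<open>b\<close> because that edge is a bridge.\<close>
  define C where "C = {k. (\<lambda>k l. {k, l} \<in> E)\<^sup>*\<^sup>* a k}"
  have "insert e E - {{a, b}} = E"
    using insert.hyps e by auto
  then have "b \<notin> C"
    using acyclic_graph_edge_is_bridge[OF insert.prems(2), of a b] e \<open>a \<noteq> b\<close>
    by (simp add: C_def)
  have "a \<in> C"
    by (simp add: C_def)
  have C_step: "i \<in> C \<Longrightarrow> j \<in> C" if "{i, j} \<in> E" for i j
    using that unfolding C_def by (auto intro: rtranclp.rtrancl_into_rtrancl)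
  then have C_iff: "i \<in> C \<longleftrightarrow> j \<in> C" if "{i, j} \<in> E" for i j
    using that by (metis insert_commute)
  \<comment> \<open>The shift is the error of \<open>x\<close> on the new edge. Every old edge has
    both ends inside or both outside \<open>C\<close>, so its difference is unchanged.\<close>
  define y where "y k = (if k \<in> C then x k + (g a b - (x a - x b)) else x k)" for k
  have y_ab: "y a - y b = g a b"
    using \<open>a \<in> C\<close> \<open>b \<notin> C\<close> by (simp add: y_def)
  have g_ba: "g b a = - g a b"
    using insert.prems(3)[of a b] e by simp
  have "y i - y j = g i j" if "{i, j} \<in> insert e E" for i j
  proof (cases "{i, j} \<in> E")
    case True
    then show ?thesis
      using C_iff[OF True] x[OF True] by (simp add: y_def)
  next
    case False
    then have "(i = a \<and> j = b) \<or> (i = b \<and> j = a)"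
      using that e by (auto simp: doubleton_eq_iff)
    then show ?thesis
      using y_ab g_ba by auto
  qed
  then show ?case by blast
qed

section \<open>Geodesic distance, sine and arcsine\<close>

lemma geodesic_dist_le_abs: "geodesic_dist x y \<le> \<bar>x - y\<bar>"
proof -
  have "geodesic_dist x y \<le> \<bar>x - y + 2 * pi * of_int 0\<bar>"
    unfolding geodesic_dist_def by (rule cINF_lower) (auto intro: bdd_belowI[of _ 0])
  then show ?thesis by simp
qed

text \<open>The infimum over all lifts is a minimum, reached at the lift in the interval from -pi to
  pi. This turns a bound on the distance into a bound on an actual real number.\<close>

lemma geodesic_dist_attained:
  obtains k :: int where "geodesic_dist x y = \<bar>x - y + 2 * pi * of_int k\<bar>"
proof -
  define t where "t k = x - y + 2 * pi * of_int k" for k :: int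
  \<comment> \<open>Rounding to the nearest integer leaves an error of at most 1/2, that is pi after
    scaling.\<close>
  define k where "k = - round ((x - y) / (2 * pi))"
  have "\<bar>(x - y) / (2 * pi) + of_int k\<bar> \<le> 1 / 2"
    using of_int_round_abs_le[of "(x - y) / (2 * pi)"] by (simp add: k_def abs_minus_commute)
  moreover have "t k = 2 * pi * ((x - y) / (2 * pi) + of_int k)"
    by (simp add: t_def field_simps)
  ultimately have t_le: "\<bar>t k\<bar> \<le> pi"
    using mult_left_mono[of "\<bar>(x - y) / (2 * pi) + of_int k\<bar>" "1 / 2" "2 * pi"]
    by (simp add: abs_mult)
  \<comment> \<open>Any other lift is at least 2 pi away from \<open>t k\<close>, so its absolute
    value is at least pi.\<close>
  have "\<bar>t k\<bar> \<le> \<bar>t m\<bar>" for m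
  proof (cases "m = k")
    case False
    then have "(1::real) \<le> \<bar>of_int (m - k)\<bar>"
      by linarith
    then have "2 * pi \<le> \<bar>2 * pi * of_int (m - k)\<bar>"
      using mult_left_mono[of 1 "\<bar>of_int (m - k)\<bar>" "2 * pi"] by (simp add: abs_mult)
    moreover have "t m - t k = 2 * pi * of_int (m - k)"
      by (simp add: t_def algebra_simps)
    ultimately show ?thesis
      using t_le by linarith
  qed simp
  then have "(INF m. \<bar>t m\<bar>) = \<bar>t k\<bar>"
    by (intro cInf_eq_minimum) auto
  then have "geodesic_dist x y = \<bar>t k\<bar>"
    by (simp add: geodesic_dist_def t_def)
  then show thesis
    using that by (simp add: t_def)
qed

text \<open>The sine does not depend on the lift, so the difference can be replaced by its shortest
  lift, which lies where the sine is increasing.\<close>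

lemma abs_sin_le_of_geodesic_dist_le:
  assumes "geodesic_dist x y \<le> c" "c < pi / 2"
  shows "\<bar>sin (x - y)\<bar> \<le> sin c"
proof -
  obtain k where k: "geodesic_dist x y = \<bar>x - y + 2 * pi * of_int k\<bar>"
    by (rule geodesic_dist_attained)
  define t where "t = x - y + 2 * pi * of_int k"
  have t: "\<bar>t\<bar> \<le> c"
    using assms k by (simp add: t_def)
  have "sin (x - y) = sin t"
    using sin_int_2pin[of k] cos_int_2pin[of k] by (simp add: t_def sin_add mult.assoc)
  moreover have "sin t \<le> sin c" "sin (- t) \<le> sin c"
    by (rule sin_monotone_2pi_le; use t assms(2) in linarith)+
  ultimately show ?thesis
    by (simp add: abs_le_iff)
qed

lemma abs_arcsin_le:
  assumes "\<bar>y\<bar> \<le> c" "c < 1"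
  shows "\<bar>arcsin y\<bar> \<le> arcsin c"
proof -
  have "arcsin y \<le> arcsin c" "arcsin (- y) \<le> arcsin c"
    using assms by (auto intro!: arcsin_le_arcsin)
  then show ?thesis
    using assms by (simp add: abs_le_iff arcsin_minus)
qed

section \<open>Passing between AC and DC feasible points\<close>

lemma P_e_eq_P_DC:
  assumes Y: "\<forall>i j. i \<noteq> j \<and> {i, j} \<notin> E \<longrightarrow> Y i j = 0"
    and \<delta>: "\<And>i j. {i, j} \<in> E \<Longrightarrow> \<delta> $ i - \<delta> $ j = sin (\<theta> $ i - \<theta> $ j)"
  shows "P_DC Y V \<delta> i = P_e Y V \<theta> i"
  unfolding P_DC_def P_e_def
proof (rule sum.cong[OF refl])
  fix j
  \<comment> \<open>Only lines contribute: on the diagonal both differences vanish, whatever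
    \<open>Y i i\<close> is, and elsewhere \<open>Y i j\<close> is zero without a line.\<close>
  show "Im (Y i j) * V i * V j * (\<delta> $ i - \<delta> $ j) = Im (Y i j) * V i * V j * sin (\<theta> $ i - \<theta> $ j)"
    using Y \<delta>[of i j] by (cases "i = j"; cases "{i, j} \<in> E") auto
qed

text \<open>The potential of the sines has the same injections, so \<open>u\<close> can be kept and
  with it the cost. The relation between the angles is exported because the comparison of minimizers
  needs it.\<close>

lemma AC_feasible_imp_DC_feasible:
  fixes E :: "'n::finite set set"
  assumes "simple_graph E" "acyclic_graph E"
    and Y: "\<forall>i j. i \<noteq> j \<and> {i, j} \<notin> E \<longrightarrow> Y i j = 0"
    and range: "\<forall>e\<in>E. \<gamma>AC e \<in> {0..<pi/2}"
    and sin: "\<forall>e\<in>E. sin (\<gamma>AC e) = \<gamma>DC e"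
    and feas: "AC_feasible E VL VI Y V P Pbar \<gamma>AC (\<theta>, u)"
  shows "\<exists>\<delta>. DC_feasible E VL VI Y V P Pbar \<gamma>DC (\<delta>, u) \<and>
    (\<forall>i j. {i, j} \<in> E \<longrightarrow> \<delta> $ i - \<delta> $ j = sin (\<theta> $ i - \<theta> $ j))"
proof -
  have "sin (\<theta> $ j - \<theta> $ i) = - sin (\<theta> $ i - \<theta> $ j)" for i j
    by (metis minus_diff_eq sin_minus)
  then obtain x where x: "\<And>i j. {i, j} \<in> E \<Longrightarrow> x i - x j = sin (\<theta> $ i - \<theta> $ j)"
    using acyclic_graph_potential[OF finite assms(1,2), of "\<lambda>i j. sin (\<theta> $ i - \<theta> $ j)"] by blast
  define \<delta> where "\<delta> = (\<chi> i. x i)"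
  have \<delta>: "\<delta> $ i - \<delta> $ j = sin (\<theta> $ i - \<theta> $ j)" if "{i, j} \<in> E" for i j
    using x[OF that] by (simp add: \<delta>_def)
  have P: "P_DC Y V \<delta> i = P_e Y V \<theta> i" for i
    using Y \<delta> by (rule P_e_eq_P_DC)
  have "\<bar>\<delta> $ i - \<delta> $ j\<bar> \<le> \<gamma>DC {i, j}" if "{i, j} \<in> E" for i j
    using feas that abs_sin_le_of_geodesic_dist_le[of "\<theta> $ i" "\<theta> $ j" "\<gamma>AC {i, j}"] range sin \<delta>[OF that]
    by (simp add: AC_feasible_def)
  then have "DC_feasible E VL VI Y V P Pbar \<gamma>DC (\<delta>, u)"
    using feas by (simp add: AC_feasible_def DC_feasible_def P)
  then show ?thesis
    using \<delta> by blast
qed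

lemma sin_mem_unit_interval:
  fixes x :: real
  assumes "x \<in> {0..<pi/2}"
  shows "sin x \<in> {0..<1}"
  using assms sin_monotone_2pi[of x "pi / 2"] by (auto intro: sin_ge_zero)

lemma DC_feasible_imp_AC_feasible:
  fixes E :: "'n::finite set set"
  assumes "simple_graph E" "acyclic_graph E"
    and Y: "\<forall>i j. i \<noteq> j \<and> {i, j} \<notin> E \<longrightarrow> Y i j = 0"
    and range: "\<forall>e\<in>E. \<gamma>AC e \<in> {0..<pi/2}"
    and sin: "\<forall>e\<in>E. sin (\<gamma>AC e) = \<gamma>DC e"
    and feas: "DC_feasible E VL VI Y V P Pbar \<gamma>DC (\<delta>, u)"
  shows "\<exists>\<theta>. AC_feasible E VL VI Y V P Pbar \<gamma>AC (\<theta>, u)"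
proof -
  \<comment> \<open>The bound below 1 keeps the DC differences in the domain where the sine inverts
    the arcsine.\<close>
  have \<gamma>: "\<gamma>AC e = arcsin (\<gamma>DC e)" "\<gamma>DC e < 1" if "e \<in> E" for e
    using that range sin sin_mem_unit_interval[of "\<gamma>AC e"] arcsin_sin[of "\<gamma>AC e"] by auto
  have le: "\<bar>\<delta> $ i - \<delta> $ j\<bar> \<le> \<gamma>DC {i, j}" if "{i, j} \<in> E" for i j
    using feas that by (simp add: DC_feasible_def)
  have "arcsin (\<delta> $ j - \<delta> $ i) = - arcsin (\<delta> $ i - \<delta> $ j)" if "{i, j} \<in> E" for i j
    using arcsin_minus[of "\<delta> $ i - \<delta> $ j"] le[OF that] \<gamma>(2)[OF that] by auto
  then obtain x where x: "\<And>i j. {i, j} \<in> E \<Longrightarrow> x i - x j = arcsin (\<delta> $ i - \<delta> $ j)"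
    using acyclic_graph_potential[OF finite assms(1,2), of "\<lambda>i j. arcsin (\<delta> $ i - \<delta> $ j)"] by blast
  define \<theta> where "\<theta> = (\<chi> i. x i)"
  have \<theta>: "\<theta> $ i - \<theta> $ j = arcsin (\<delta> $ i - \<delta> $ j)" if "{i, j} \<in> E" for i j
    using x[OF that] by (simp add: \<theta>_def)
  have "\<delta> $ i - \<delta> $ j = sin (\<theta> $ i - \<theta> $ j)" if "{i, j} \<in> E" for i j
    using \<theta>[OF that] le[OF that] \<gamma>(2)[OF that] by auto
  with Y have P: "P_DC Y V \<delta> i = P_e Y V \<theta> i" for i
    by (rule P_e_eq_P_DC)
  \<comment> \<open>The plain difference is one of the lifts, so its absolute value bounds the
    geodesic distance from above.\<close>
  have "geodesic_dist (\<theta> $ i) (\<theta> $ j) \<le> \<gamma>AC {i, j}" if "{i, j} \<in> E" for i j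
    using geodesic_dist_le_abs[of "\<theta> $ i" "\<theta> $ j"] abs_arcsin_le[OF le[OF that] \<gamma>(2)[OF that]]
      \<theta>[OF that] \<gamma>(1)[OF that] by simp
  then have "AC_feasible E VL VI Y V P Pbar \<gamma>AC (\<theta>, u)"
    using feas by (simp add: AC_feasible_def DC_feasible_def P)
  then show ?thesis ..
qed

section \<open>Minimizers and uniqueness of the optimal inverter vector\<close>

lemma AC_minimizer_iff:
  "AC_minimizer E VL VI Y V P Pbar \<alpha> \<gamma> (\<theta>, u) \<longleftrightarrow> AC_feasible E VL VI Y V P Pbar \<gamma> (\<theta>, u) \<and>
    (\<forall>\<theta>' u'. AC_feasible E VL VI Y V P Pbar \<gamma> (\<theta>', u') \<longrightarrow> dispatch_cost VI \<alpha> u \<le> dispatch_cost VI \<alpha> u')"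
  by (auto simp: AC_minimizer_def is_arg_min_linorder)

lemma DC_minimizer_iff:
  "DC_minimizer E VL VI Y V P Pbar \<alpha> \<gamma> (\<delta>, v) \<longleftrightarrow> DC_feasible E VL VI Y V P Pbar \<gamma> (\<delta>, v) \<and>
    (\<forall>\<delta>' v'. DC_feasible E VL VI Y V P Pbar \<gamma> (\<delta>', v') \<longrightarrow> dispatch_cost VI \<alpha> v \<le> dispatch_cost VI \<alpha> v')"
  by (auto simp: DC_minimizer_def is_arg_min_linorder)

lemma P_DC_add: "P_DC Y V (x + y) i = P_DC Y V x i + P_DC Y V y i"
  by (simp add: P_DC_def sum.distrib[symmetric] algebra_simps)

lemma P_DC_scaleR: "P_DC Y V (c *\<^sub>R x) i = c * P_DC Y V x i"
  by (simp add: P_DC_def sum_distrib_left algebra_simps)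

text \<open>All DC constraints are affine equations or convex bounds, since \<open>P_DC\<close> is
  linear in the angles. Midpoints are all the convexity that uniqueness needs; restricting the
  function to \<open>VI\<close> keeps the vector extensional.\<close>

lemma DC_feasible_midpoint:
  assumes "DC_feasible E VL VI Y V P Pbar \<gamma> (\<delta>, u)" "DC_feasible E VL VI Y V P Pbar \<gamma> (\<delta>', v)"
  shows "DC_feasible E VL VI Y V P Pbar \<gamma> ((1 / 2) *\<^sub>R (\<delta> + \<delta>'), \<lambda>i\<in>VI. (u i + v i) / 2)"
proof -
  let ?m = "(1 / 2) *\<^sub>R (\<delta> + \<delta>')"
  have P: "P_DC Y V ?m i = (P_DC Y V \<delta> i + P_DC Y V \<delta>' i) / 2" for i
    by (simp only: P_DC_scaleR P_DC_add)
  have "P i + (u i + v i) / 2 = P_DC Y V ?m i" if "i \<in> VI" for i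
  proof -
    have "P i + u i = P_DC Y V \<delta> i" "P i + v i = P_DC Y V \<delta>' i"
      using assms that by (auto simp: DC_feasible_def)
    then show ?thesis unfolding P by (simp add: field_simps)
  qed
  moreover have "P i = P_DC Y V ?m i" if "i \<in> VL" for i
  proof -
    have "P i = P_DC Y V \<delta> i" "P i = P_DC Y V \<delta>' i"
      using assms that by (auto simp: DC_feasible_def)
    then show ?thesis unfolding P by simp
  qed
  moreover have "\<bar>?m $ i - ?m $ j\<bar> \<le> \<gamma> {i, j}" if "{i, j} \<in> E" for i j
  proof -
    have "\<bar>\<delta> $ i - \<delta> $ j\<bar> \<le> \<gamma> {i, j}" "\<bar>\<delta>' $ i - \<delta>' $ j\<bar> \<le> \<gamma> {i, j}"
      using assms that by (auto simp: DC_feasible_def)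
    then show ?thesis by (simp add: field_simps abs_le_iff)
  qed
  moreover have "P_DC Y V ?m i \<in> {0..Pbar i}" if "i \<in> VI" for i
  proof -
    have "P_DC Y V \<delta> i \<in> {0..Pbar i}" "P_DC Y V \<delta>' i \<in> {0..Pbar i}"
      using assms that by (auto simp: DC_feasible_def)
    then show ?thesis unfolding P by auto
  qed
  ultimately show ?thesis
    unfolding DC_feasible_def by simp
qed

text \<open>The parallelogram identity in each coordinate. The subtracted sum is the quantitative
  form of strict convexity.\<close>

lemma dispatch_cost_midpoint:
  "dispatch_cost VI \<alpha> (\<lambda>i\<in>VI. (u i + v i) / 2) =
     (dispatch_cost VI \<alpha> u + dispatch_cost VI \<alpha> v) / 2 - (\<Sum>i\<in>VI. \<alpha> i * (u i - v i)\<^sup>2) / 8"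
proof -
  have "1 / 2 * a * ((x + y) / 2)\<^sup>2 = (1 / 2 * a * x\<^sup>2 + 1 / 2 * a * y\<^sup>2) / 2 - a * (x - y)\<^sup>2 / 8"
    for a x y :: real
    by (simp add: power2_eq_square algebra_simps add_divide_distrib diff_divide_distrib)
  then show ?thesis
    by (simp add: dispatch_cost_def sum.distrib sum_subtractf sum_divide_distrib[symmetric])
qed

text \<open>Unless \<open>u\<close> and \<open>v\<close> coincide, their midpoint would be feasible
  and cheaper than \<open>v\<close>. Assuming a cost comparison rather than minimality of
  \<open>u\<close> lets the lemma accept a vector that comes from the AC problem.\<close>

lemma DC_minimizer_unique:
  fixes VI :: "'n::finite set"
  assumes \<alpha>: "\<And>i. i \<in> VI \<Longrightarrow> \<alpha> i > 0"
    and min: "DC_minimizer E VL VI Y V P Pbar \<alpha> \<gamma> (\<delta>, v)"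
    and feas: "DC_feasible E VL VI Y V P Pbar \<gamma> (\<delta>', u)"
    and le: "dispatch_cost VI \<alpha> u \<le> dispatch_cost VI \<alpha> v"
  shows "u = v"
proof -
  have feas': "DC_feasible E VL VI Y V P Pbar \<gamma> (\<delta>, v)"
    using min by (simp add: DC_minimizer_iff)
  have "dispatch_cost VI \<alpha> v \<le> dispatch_cost VI \<alpha> (\<lambda>i\<in>VI. (u i + v i) / 2)"
    using min DC_feasible_midpoint[OF feas feas'] by (simp add: DC_minimizer_iff)
  then have "(\<Sum>i\<in>VI. \<alpha> i * (u i - v i)\<^sup>2) \<le> 0"
    using le unfolding dispatch_cost_midpoint by (simp add: field_simps)
  moreover have nonneg: "0 \<le> \<alpha> i * (u i - v i)\<^sup>2" if "i \<in> VI" for i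
    using \<alpha>[OF that] by simp
  ultimately have "(\<Sum>i\<in>VI. \<alpha> i * (u i - v i)\<^sup>2) = 0"
    by (meson antisym sum_nonneg)
  then have "\<forall>i\<in>VI. \<alpha> i * (u i - v i)\<^sup>2 = 0"
    using nonneg by (subst (asm) sum_nonneg_eq_0_iff) auto
  then have "u i = v i" if "i \<in> VI" for i
    using that \<alpha>[OF that] by force
  then show ?thesis
    using feas feas' by (auto simp: DC_feasible_def intro: PiE_ext)
qed

section \<open>The energy form of the DC injections\<close>

lemma P_DC_energy:
  assumes sym: "\<And>i j. Im (Y i j) = Im (Y j i)"
  shows "2 * (\<Sum>i\<in>UNIV. x $ i * P_DC Y V x i) =
    (\<Sum>i\<in>UNIV. \<Sum>j\<in>UNIV. Im (Y i j) * V i * V j * (x $ i - x $ j)\<^sup>2)"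
proof -
  let ?s = "\<lambda>i j. x $ i * (Im (Y i j) * V i * V j * (x $ i - x $ j))"
  have "(\<Sum>i\<in>UNIV. x $ i * P_DC Y V x i) = (\<Sum>i\<in>UNIV. \<Sum>j\<in>UNIV. ?s i j)"
    by (simp add: P_DC_def sum_distrib_left)
  \<comment> \<open>Adding the sum to its copy with exchanged indices symmetrises the summand into a
    weighted square.\<close>
  moreover have "(\<Sum>i\<in>UNIV. \<Sum>j\<in>UNIV. ?s i j) = (\<Sum>i\<in>UNIV. \<Sum>j\<in>UNIV. ?s j i)"
    by (rule sum.swap)
  ultimately have "2 * (\<Sum>i\<in>UNIV. x $ i * P_DC Y V x i) = (\<Sum>i\<in>UNIV. \<Sum>j\<in>UNIV. ?s i j + ?s j i)"
    by (simp add: sum.distrib)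
  moreover have "?s i j + ?s j i = Im (Y i j) * V i * V j * (x $ i - x $ j)\<^sup>2" for i j
    using sym[of i j] by (simp add: power2_eq_square algebra_simps)
  ultimately show ?thesis
    by simp
qed

text \<open>The difference of the two angle vectors has zero injections, hence zero energy. Each
  term of the energy is nonnegative and so vanishes, which equates the two ends wherever the weight
  is positive.\<close>

lemma P_DC_determines_edge_differences:
  assumes sym: "\<And>i j. Im (Y i j) = Im (Y j i)"
    and nonneg: "\<And>i j. i \<noteq> j \<Longrightarrow> 0 \<le> Im (Y i j)"
    and V: "\<And>i. 0 < V i"
    and eq: "\<And>i. P_DC Y V \<delta> i = P_DC Y V \<delta>' i"
    and pos: "0 < Im (Y i j)"
  shows "\<delta> $ i - \<delta> $ j = \<delta>' $ i - \<delta>' $ j"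
proof -
  \<comment> \<open>Written with a scalar multiple so that the linearity lemmas for
    \<open>P_DC\<close> apply.\<close>
  define x where "x = \<delta> + (- 1) *\<^sub>R \<delta>'"
  let ?t = "\<lambda>i j. Im (Y i j) * V i * V j * (x $ i - x $ j)\<^sup>2"
  have "P_DC Y V x i = 0" for i
    by (simp only: x_def P_DC_add P_DC_scaleR eq)
  then have sum0: "(\<Sum>i\<in>UNIV. \<Sum>j\<in>UNIV. ?t i j) = 0"
    using P_DC_energy[of Y x V, OF sym] by simp
  \<comment> \<open>A diagonal admittance may have any sign, but there the square is zero.\<close>
  have t: "0 \<le> ?t i j" for i j
    using nonneg[of i j] V[of i] V[of j] by (cases "i = j") auto
  then have "\<forall>i\<in>UNIV. (\<Sum>j\<in>UNIV. ?t i j) = 0"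
    using sum0 by (subst (asm) sum_nonneg_eq_0_iff) (auto intro: sum_nonneg)
  then have "(\<Sum>j\<in>UNIV. ?t i j) = 0"
    by blast
  then have "\<forall>j\<in>UNIV. ?t i j = 0"
    using t by (subst (asm) sum_nonneg_eq_0_iff) auto
  then have "?t i j = 0"
    by blast
  then have "x $ i = x $ j"
    using pos V[of i] V[of j] by simp
  then show ?thesis
    by (simp add: x_def)
qed

text \<open>The ends must differ: in \<open>incidence\<close> the sink takes precedence, so a loop
  would give \<open>x $ snk e\<close> instead of 0.\<close>

lemma incidence_transpose_mult_incidence:
  assumes "src e \<noteq> snk e"
  shows "incidence_transpose_mult (incidence src snk) x e = x $ snk e - x $ src e"
proof -
  have "incidence_transpose_mult (incidence src snk) x e =
    (\<Sum>i\<in>UNIV. (if i = snk e then x $ i else 0) - (if i = src e then x $ i else 0))"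
    unfolding incidence_transpose_mult_def incidence_def
    using assms by (intro sum.cong) auto
  also have "\<dots> = x $ snk e - x $ src e"
    by (simp add: sum_subtractf)
  finally show ?thesis .
qed

section \<open>Equivalence of solvability and agreement of the minimizers\<close>

lemma AC_solvable_imp_DC_solvable:
  fixes E :: "'n::finite set set"
  assumes graph: "simple_graph E" "acyclic_graph E"
    and Y: "\<forall>i j. i \<noteq> j \<and> {i, j} \<notin> E \<longrightarrow> Y i j = 0"
    and AC: "AC_solvable E VL VI Y V P Pbar \<alpha> \<gamma>"
  shows "DC_solvable E VL VI Y V P Pbar \<alpha> (\<lambda>e. sin (\<gamma> e))"
proof -
  from AC obtain \<theta> u where range: "\<forall>e\<in>E. \<gamma> e \<in> {0..<pi/2}"
    and min: "AC_minimizer E VL VI Y V P Pbar \<alpha> \<gamma> (\<theta>, u)"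
    unfolding AC_solvable_def by blast
  have feas: "AC_feasible E VL VI Y V P Pbar \<gamma> (\<theta>, u)"
    and opt: "\<And>\<theta>' u'. AC_feasible E VL VI Y V P Pbar \<gamma> (\<theta>', u') \<Longrightarrow>
      dispatch_cost VI \<alpha> u \<le> dispatch_cost VI \<alpha> u'"
    using min by (auto simp: AC_minimizer_iff)
  obtain \<delta> where feas': "DC_feasible E VL VI Y V P Pbar (\<lambda>e. sin (\<gamma> e)) (\<delta>, u)"
    using AC_feasible_imp_DC_feasible[OF graph Y range _ feas, where \<gamma>DC = "\<lambda>e. sin (\<gamma> e)"] by blast
  \<comment> \<open>Every DC competitor has an AC counterpart with the same inverter vector, so it
    cannot be cheaper than \<open>u\<close>.\<close>
  have "dispatch_cost VI \<alpha> u \<le> dispatch_cost VI \<alpha> v"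
    if "DC_feasible E VL VI Y V P Pbar (\<lambda>e. sin (\<gamma> e)) (\<delta>', v)" for \<delta>' v
    using DC_feasible_imp_AC_feasible[OF graph Y range _ that] opt by blast
  with feas' have "DC_minimizer E VL VI Y V P Pbar \<alpha> (\<lambda>e. sin (\<gamma> e)) (\<delta>, u)"
    by (simp add: DC_minimizer_iff)
  \<comment> \<open>The sines lie below 1, and 1 is below pi/2 because pi exceeds 3.\<close>
  moreover have "\<forall>e\<in>E. sin (\<gamma> e) \<in> {0..<pi/2} \<and> sin (\<gamma> e) < 1"
    using range sin_mem_unit_interval pi_gt3 by fastforce
  ultimately show ?thesis
    by (auto simp: DC_solvable_def)
qed

text \<open>The bound \<open>\<gamma> e < 1\<close> puts the arcsines into the range of admissible
  AC parameters. Their sines give back \<open>\<gamma>\<close>, so the same two transfer lemmas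
  apply.\<close>

lemma DC_solvable_imp_AC_solvable:
  fixes E :: "'n::finite set set"
  assumes graph: "simple_graph E" "acyclic_graph E"
    and Y: "\<forall>i j. i \<noteq> j \<and> {i, j} \<notin> E \<longrightarrow> Y i j = 0"
    and DC: "DC_solvable E VL VI Y V P Pbar \<alpha> \<gamma>"
  shows "AC_solvable E VL VI Y V P Pbar \<alpha> (\<lambda>e. arcsin (\<gamma> e))"
proof -
  let ?\<gamma> = "\<lambda>e. arcsin (\<gamma> e)"
  from DC obtain \<delta> v where \<gamma>: "\<And>e. e \<in> E \<Longrightarrow> 0 \<le> \<gamma> e \<and> \<gamma> e < 1"
    and min: "DC_minimizer E VL VI Y V P Pbar \<alpha> \<gamma> (\<delta>, v)"
    unfolding DC_solvable_def by auto
  have feas: "DC_feasible E VL VI Y V P Pbar \<gamma> (\<delta>, v)"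
    and opt: "\<And>\<delta>' v'. DC_feasible E VL VI Y V P Pbar \<gamma> (\<delta>', v') \<Longrightarrow>
      dispatch_cost VI \<alpha> v \<le> dispatch_cost VI \<alpha> v'"
    using min by (auto simp: DC_minimizer_iff)
  have "?\<gamma> e \<in> {0..<pi/2}" if "e \<in> E" for e
    using \<gamma>[OF that] arcsin_le_arcsin[of 0 "\<gamma> e"] arcsin_lt_bounded[of "\<gamma> e"] by auto
  then have range: "\<forall>e\<in>E. ?\<gamma> e \<in> {0..<pi/2}" ..
  have "sin (?\<gamma> e) = \<gamma> e" if "e \<in> E" for e
    using \<gamma>[OF that] by simp
  then have sin: "\<forall>e\<in>E. sin (?\<gamma> e) = \<gamma> e" ..
  obtain \<theta> where feas': "AC_feasible E VL VI Y V P Pbar ?\<gamma> (\<theta>, v)"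
    using DC_feasible_imp_AC_feasible[OF graph Y range sin feas] ..
  have "dispatch_cost VI \<alpha> v \<le> dispatch_cost VI \<alpha> u"
    if "AC_feasible E VL VI Y V P Pbar ?\<gamma> (\<theta>', u)" for \<theta>' u
    using AC_feasible_imp_DC_feasible[OF graph Y range sin that] opt by blast
  with feas' have "AC_minimizer E VL VI Y V P Pbar \<alpha> ?\<gamma> (\<theta>, v)"
    by (simp add: AC_minimizer_iff)
  with range show ?thesis
    by (auto simp: AC_solvable_def)
qed

text \<open>Both vectors are feasible for both problems, so AC optimality makes \<open>u\<close> no
  dearer than \<open>v\<close>, and uniqueness on the DC side identifies them. The angle vector
  \<open>\<delta>'\<close> obtained from \<open>\<theta>\<close> then has the injections of
  \<open>\<delta>\<close>, hence the same differences along the lines.\<close>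

lemma AC_DC_minimizers_agree:
  fixes E :: "'n::finite set set"
  assumes graph: "simple_graph E" "acyclic_graph E"
    and partition: "VL \<union> VI = UNIV"
    and Y: "\<forall>i j. i \<noteq> j \<and> {i, j} \<notin> E \<longrightarrow> Y i j = 0"
    and Y_sym: "\<And>i j. Im (Y i j) = Im (Y j i)"
    and Y_pos: "\<And>i j. {i, j} \<in> E \<Longrightarrow> 0 < Im (Y i j)"
    and V: "\<And>i. 0 < V i"
    and \<alpha>: "\<And>i. i \<in> VI \<Longrightarrow> \<alpha> i > 0"
    and range: "\<forall>e\<in>E. \<gamma>AC e \<in> {0..<pi/2}"
    and sin: "\<forall>e\<in>E. sin (\<gamma>AC e) = \<gamma>DC e"
    and AC: "AC_minimizer E VL VI Y V P Pbar \<alpha> \<gamma>AC (\<theta>, u)"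
    and DC: "DC_minimizer E VL VI Y V P Pbar \<alpha> \<gamma>DC (\<delta>, v)"
  shows "u = v" and "\<And>i j. {i, j} \<in> E \<Longrightarrow> sin (\<theta> $ i - \<theta> $ j) = \<delta> $ i - \<delta> $ j"
proof -
  have feasA: "AC_feasible E VL VI Y V P Pbar \<gamma>AC (\<theta>, u)"
    and optA: "\<And>\<theta>' u'. AC_feasible E VL VI Y V P Pbar \<gamma>AC (\<theta>', u') \<Longrightarrow>
      dispatch_cost VI \<alpha> u \<le> dispatch_cost VI \<alpha> u'"
    using AC by (auto simp: AC_minimizer_iff)
  have feasD: "DC_feasible E VL VI Y V P Pbar \<gamma>DC (\<delta>, v)"
    using DC by (simp add: DC_minimizer_iff)
  obtain \<delta>' where feasD': "DC_feasible E VL VI Y V P Pbar \<gamma>DC (\<delta>', u)"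
    and \<delta>': "\<And>i j. {i, j} \<in> E \<Longrightarrow> \<delta>' $ i - \<delta>' $ j = sin (\<theta> $ i - \<theta> $ j)"
    using AC_feasible_imp_DC_feasible[OF graph Y range sin feasA] by blast
  obtain \<theta>' where "AC_feasible E VL VI Y V P Pbar \<gamma>AC (\<theta>', v)"
    using DC_feasible_imp_AC_feasible[OF graph Y range sin feasD] ..
  then have "dispatch_cost VI \<alpha> u \<le> dispatch_cost VI \<alpha> v"
    by (rule optA)
  with \<alpha> DC feasD' show "u = v"
    by (rule DC_minimizer_unique)
  \<comment> \<open>Injections are prescribed at the loads and equal to \<open>P i + u i\<close> at
    the inverters, and every node is one or the other.\<close>
  have "P_DC Y V \<delta>' i = P_DC Y V \<delta> i" for i
  proof -
    have "i \<in> VL \<or> i \<in> VI"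
      using partition by blast
    then show ?thesis
      using feasD feasD' \<open>u = v\<close> by (auto simp: DC_feasible_def)
  qed
  moreover have "0 \<le> Im (Y i j)" if "i \<noteq> j" for i j
    using Y_pos[of i j] Y that by (cases "{i, j} \<in> E") auto
  ultimately have "\<delta>' $ i - \<delta>' $ j = \<delta> $ i - \<delta> $ j" if "{i, j} \<in> E" for i j
    using P_DC_determines_edge_differences[of Y V \<delta>' \<delta> i j] Y_sym V Y_pos[OF that] by blast
  with \<delta>' show "sin (\<theta> $ i - \<theta> $ j) = \<delta> $ i - \<delta> $ j" if "{i, j} \<in> E" for i j
    using that by simp
qed

theorem theoremV1:
  fixes E :: "'n::finite set set"
    and src snk :: "'n set \<Rightarrow> 'n"
    and VL VI :: "'n set"
    and z :: "'n set \<Rightarrow> complex"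
    and Y :: "'n \<Rightarrow> 'n \<Rightarrow> complex"
    and V P Pbar \<alpha> :: "'n \<Rightarrow> real"
    and B :: "'n \<Rightarrow> 'n set \<Rightarrow> real"
  assumes graph: "simple_graph E" "connected_graph E" "acyclic_graph E"
    and incidence: "orientation E src snk" "B = incidence src snk"
    and partition: "VL \<union> VI = UNIV" "VL \<inter> VI = {}"
    and inductive_lines: "\<forall>e\<in>E. Re (z e) = 0 \<and> Im (z e) > 0"
    and admittance: "\<forall>i j. {i, j} \<in> E \<longrightarrow> Im (Y i j) = 1 / cmod (z {i, j})"
      "\<forall>i j. i \<noteq> j \<and> {i, j} \<notin> E \<longrightarrow> Y i j = 0"
    and voltages: "\<forall>i. V i > 0"
    and ratings: "\<forall>i\<in>VI. Pbar i \<ge> 0"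
    and setpoints: "\<forall>i\<in>VI. P i \<in> {0..Pbar i}"
    and balance: "0 \<le> - (\<Sum>i\<in>VL. P i)" "- (\<Sum>i\<in>VL. P i) \<le> (\<Sum>i\<in>VI. Pbar i)"
    and cost: "\<forall>i\<in>VI. \<alpha> i > 0"
  shows
    "((\<exists>\<gamma>AC. AC_solvable E VL VI Y V P Pbar \<alpha> \<gamma>AC) \<longleftrightarrow>
      (\<exists>\<gamma>DC. DC_solvable E VL VI Y V P Pbar \<alpha> \<gamma>DC)) \<and>
     (\<forall>\<gamma>AC. AC_solvable E VL VI Y V P Pbar \<alpha> \<gamma>AC \<longrightarrow>
       (\<exists>\<gamma>DC. DC_solvable E VL VI Y V P Pbar \<alpha> \<gamma>DC \<and> (\<forall>e\<in>E. sin (\<gamma>AC e) = \<gamma>DC e))) \<and>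
     (\<forall>\<gamma>DC. DC_solvable E VL VI Y V P Pbar \<alpha> \<gamma>DC \<longrightarrow>
       (\<exists>\<gamma>AC. AC_solvable E VL VI Y V P Pbar \<alpha> \<gamma>AC \<and> (\<forall>e\<in>E. sin (\<gamma>AC e) = \<gamma>DC e))) \<and>
     (\<forall>\<gamma>AC \<gamma>DC \<theta> u \<delta> v.
       AC_solvable E VL VI Y V P Pbar \<alpha> \<gamma>AC \<and>
       DC_solvable E VL VI Y V P Pbar \<alpha> \<gamma>DC \<and>
       (\<forall>e\<in>E. sin (\<gamma>AC e) = \<gamma>DC e) \<and>
       AC_minimizer E VL VI Y V P Pbar \<alpha> \<gamma>AC (\<theta>, u) \<and>
       DC_minimizer E VL VI Y V P Pbar \<alpha> \<gamma>DC (\<delta>, v) \<longrightarrow>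
         u = v \<and>
         (\<forall>e\<in>E. sin (incidence_transpose_mult B \<theta> e) = incidence_transpose_mult B \<delta> e) \<and>
         dispatch_cost VI \<alpha> u = dispatch_cost VI \<alpha> v \<and>
         (\<forall>\<theta>' u'. AC_feasible E VL VI Y V P Pbar \<gamma>AC (\<theta>', u') \<longrightarrow>
            dispatch_cost VI \<alpha> u \<le> dispatch_cost VI \<alpha> u') \<and>
         (\<forall>\<delta>' v'. DC_feasible E VL VI Y V P Pbar \<gamma>DC (\<delta>', v') \<longrightarrow>
            dispatch_cost VI \<alpha> v \<le> dispatch_cost VI \<alpha> v'))"
proof -
  have Y_pos: "0 < Im (Y i j)" if "{i, j} \<in> E" for i j
    using inductive_lines admittance(1) that by force
  \<comment> \<open>On a line the value depends only on the unordered pair; off the lines and off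
    the diagonal it is zero.\<close>
  have Y_sym: "Im (Y i j) = Im (Y j i)" for i j
    using admittance
    by (cases "i = j"; cases "{i, j} \<in> E") (auto simp: insert_commute)
  have AC_DC: "DC_solvable E VL VI Y V P Pbar \<alpha> (\<lambda>e. sin (\<gamma>AC e))"
    if "AC_solvable E VL VI Y V P Pbar \<alpha> \<gamma>AC" for \<gamma>AC
    using graph(1,3) admittance(2) that by (rule AC_solvable_imp_DC_solvable)
  have DC_AC: "AC_solvable E VL VI Y V P Pbar \<alpha> (\<lambda>e. arcsin (\<gamma>DC e))"
    if "DC_solvable E VL VI Y V P Pbar \<alpha> \<gamma>DC" for \<gamma>DC
    using graph(1,3) admittance(2) that by (rule DC_solvable_imp_AC_solvable)
  have sin_arcsin: "\<forall>e\<in>E. sin (arcsin (\<gamma>DC e)) = \<gamma>DC e"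
    if "DC_solvable E VL VI Y V P Pbar \<alpha> \<gamma>DC" for \<gamma>DC
    using that by (auto simp: DC_solvable_def)
  \<comment> \<open>The product with the transposed incidence matrix is sink minus source, so the
    edge is needed in this order.\<close>
  have edge: "src e \<noteq> snk e" "{snk e, src e} \<in> E" if "e \<in> E" for e
  proof -
    have e: "e = {src e, snk e}" and card: "card e = 2"
      using incidence(1) graph(1) that by (auto simp: orientation_def simple_graph_def)
    show "src e \<noteq> snk e"
      using e card by (metis card_2_iff doubleton_eq_iff)
    show "{snk e, src e} \<in> E"
      using e that by (metis insert_commute)
  qed
  show ?thesis
  proof (intro conjI, goal_cases)
    case 1
    show ?case
      using AC_DC DC_AC by blast
  next
    case 2
    show ?case
      using AC_DC by blast
  next
    case 3
    show ?case
      using DC_AC sin_arcsin by blast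
  next
    case 4
    show ?case
    proof (intro allI impI, elim conjE, goal_cases)
      case (1 \<gamma>AC \<gamma>DC \<theta> u \<delta> v)
      then have range: "\<forall>e\<in>E. \<gamma>AC e \<in> {0..<pi/2}"
        by (simp add: AC_solvable_def)
      note facts = graph(1,3) partition(1) admittance(2) Y_sym Y_pos voltages[rule_format] cost[rule_format]
        range 1(3-5)
      have "u = v"
        using facts by (rule AC_DC_minimizers_agree)
      moreover have "sin (\<theta> $ i - \<theta> $ j) = \<delta> $ i - \<delta> $ j" if "{i, j} \<in> E" for i j
        using facts that by (rule AC_DC_minimizers_agree)
      \<comment> \<open>Equal costs follow from \<open>u = v\<close>; the two global minimality
        claims are part of being a minimizer.\<close>
      ultimately show ?case
        using edge 1(4,5)
        by (simp add: AC_minimizer_iff DC_minimizer_iff incidence(2)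
            incidence_transpose_mult_incidence)
    qed
  qed
qed

end
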